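(* Let $(X,T)$ be a dynamical system and $n\geq 2$. Then the following statements are equivalent: (1) $(X,T)$ is $n$-tuplewise thickly sensitive; (2) there is a constant $\delta>0$ with the property that for each non-empty open subset $U$ of $X$ there exist $x_1,\dots,x_n\in U$ and $y_1,\dots,y_n\in X$ such that $(x_1,\dots,x_n)$ is proximal to $(y_1,\dots,y_n)$ in the $n$-fold product system $(X^n,T^{(n)})$ and $$\liminf_{m\to\infty}\min_{1\le i<j\le n}d(T^my_i,T^my_j)\ge\delta;$$ (3) there is a constant $\delta>0$ with the property that for each non-empty open subset $U$ of $X$ there exist $x_1,\dots,x_n\in U$ and $y_1,\dots,y_n\in X$ such that $(y_1,\dots,y_n)$ is a minimal point of $(X^n,T^{(n)})$, $(x_1,\dots,x_n)$ is proximal to $(y_1,\dots,y_n)$ in $(X^n,T^{(n)})$, and $$\liminf_{m\to\infty}\min_{1\le i<j\le n}d(T^my_i,T^my_j)\ge\delta.$$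
   Context: A dynamical system is a pair $(X,T)$ where $X$ is a compact metric space with metric $d$ and $T\colon X\to X$ is a continuous surjection. $\mathbb{N}$ is the set of positive integers. The $n$-fold product system is $(X^n,T^{(n)})$ with $T^{(n)}(x_1,\dots,x_n)=(Tx_1,\dots,Tx_n)$, where $X^n$ carries any metric compatible with the product topology. In a system with metric $d$, a pair $(x,y)$ is proximal ($x$ is proximal to $y$) if $\liminf_{k\to\infty}d(T^kx,T^ky)=0$. A subsystem is a non-empty closed $Y\subset X$ with $TY\subset Y$; a system is minimal if it has no proper subsystem. A point $x$ is minimal if its orbit closure $\overline{\{T^kx:k\ge0\}}$ is a minimal subsystem. A set $F\subset\mathbb{N}$ is thick if for every $L\in\mathbb{N}$ there is $m\in\mathbb{N}$ with $\{m,m+1,\dots,m+L\}\subset F$. $(X,T)$ is $n$-tuplewise thickly sensitive if there is a constant $\delta>0$ such that for every non-empty open $U\subset X$ there exist $x_1,\dots,x_n\in U$ such that $\{k\in\mathbb{N}: \min_{1\le i<j\le n}d(T^kx_i,T^kx_j)>\delta\}$ is thick. *)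

theory Defs
  imports "HOL-Analysis.Analysis"
begin

text \<open>
  A system is given by a carrier \<open>M\<close>, a metric \<open>d\<close> on \<open>M\<close> and a map \<open>T\<close>; the values of \<open>d\<close> and
  \<open>T\<close> outside \<open>M\<close> are irrelevant.
\<close>

definition dynamical_system :: "'a set \<Rightarrow> ('a \<Rightarrow> 'a \<Rightarrow> real) \<Rightarrow> ('a \<Rightarrow> 'a) \<Rightarrow> bool" where
  "dynamical_system M d T \<longleftrightarrow>
     Metric_space M d \<and>
     compact_space (Metric_space.mtopology M d) \<and>
     continuous_map (Metric_space.mtopology M d) (Metric_space.mtopology M d) T \<and>
     T ` M = M"

text \<open>The lower limit is taken in \<^typ>\<open>ereal\<close>, since \<^typ>\<open>real\<close> is not a complete lattice.\<close>

definition proximal :: "('a \<Rightarrow> 'a \<Rightarrow> real) \<Rightarrow> ('a \<Rightarrow> 'a) \<Rightarrow> 'a \<Rightarrow> 'a \<Rightarrow> bool" where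
  "proximal d T x y \<longleftrightarrow> liminf (\<lambda>k. ereal (d ((T ^^ k) x) ((T ^^ k) y))) = 0"

definition subsystem :: "'a set \<Rightarrow> ('a \<Rightarrow> 'a \<Rightarrow> real) \<Rightarrow> ('a \<Rightarrow> 'a) \<Rightarrow> 'a set \<Rightarrow> bool" where
  "subsystem M d T Y \<longleftrightarrow>
     Y \<noteq> {} \<and> closedin (Metric_space.mtopology M d) Y \<and> T ` Y \<subseteq> Y"

definition minimal_system :: "'a set \<Rightarrow> ('a \<Rightarrow> 'a \<Rightarrow> real) \<Rightarrow> ('a \<Rightarrow> 'a) \<Rightarrow> bool" where
  "minimal_system M d T \<longleftrightarrow> (\<forall>Y. subsystem M d T Y \<longrightarrow> Y = M)"

definition orbit_closure :: "'a set \<Rightarrow> ('a \<Rightarrow> 'a \<Rightarrow> real) \<Rightarrow> ('a \<Rightarrow> 'a) \<Rightarrow> 'a \<Rightarrow> 'a set" where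
  "orbit_closure M d T x = Metric_space.mtopology M d closure_of range (\<lambda>k. (T ^^ k) x)"

definition minimal_point :: "'a set \<Rightarrow> ('a \<Rightarrow> 'a \<Rightarrow> real) \<Rightarrow> ('a \<Rightarrow> 'a) \<Rightarrow> 'a \<Rightarrow> bool" where
  "minimal_point M d T x \<longleftrightarrow>
     x \<in> M \<and> subsystem M d T (orbit_closure M d T x) \<and> minimal_system (orbit_closure M d T x) d T"

text \<open>
  Points of the \<open>n\<close>-fold product are the extensional functions in \<open>{1..n} \<rightarrow>\<^sub>E M\<close>.
\<close>

definition product_map :: "nat \<Rightarrow> ('a \<Rightarrow> 'a) \<Rightarrow> (nat \<Rightarrow> 'a) \<Rightarrow> (nat \<Rightarrow> 'a)" where
  "product_map n T x = (\<lambda>i\<in>{1..n}. T (x i))"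

definition compatible_product_metric ::
    "nat \<Rightarrow> 'a set \<Rightarrow> ('a \<Rightarrow> 'a \<Rightarrow> real) \<Rightarrow> ((nat \<Rightarrow> 'a) \<Rightarrow> (nat \<Rightarrow> 'a) \<Rightarrow> real) \<Rightarrow> bool" where
  "compatible_product_metric n M d D \<longleftrightarrow>
     Metric_space ({1..n} \<rightarrow>\<^sub>E M) D \<and>
     Metric_space.mtopology ({1..n} \<rightarrow>\<^sub>E M) D =
       product_topology (\<lambda>_. Metric_space.mtopology M d) {1..n}"

lemma compatible_product_metric_exists:
  assumes "Metric_space M d"
  shows "\<exists>D. compatible_product_metric n M d D"
proof -
  interpret Metric_space M d by fact
  have "metrizable_space (product_topology (\<lambda>_. mtopology) {1..n})"
    unfolding metrizable_space_product_topology
    using metrizable_space_mtopology by (simp add: countable_finite)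
  then obtain N D where D: "Metric_space N D"
      "product_topology (\<lambda>_. mtopology) {1..n} = Metric_space.mtopology N D"
    unfolding metrizable_space_def by blast
  have "N = topspace (Metric_space.mtopology N D)"
    by (rule Metric_space.topspace_mtopology [OF D(1), symmetric])
  also have "\<dots> = {1..n} \<rightarrow>\<^sub>E M"
    unfolding D(2) [symmetric] by simp
  finally have "N = {1..n} \<rightarrow>\<^sub>E M" .
  with D show ?thesis
    unfolding compatible_product_metric_def by (intro exI [of _ D]) simp
qed

text \<open>Only meaningful for \<open>n \<ge> 2\<close>, where the minimum is over a non-empty finite set.\<close>

definition min_separation :: "('a \<Rightarrow> 'a \<Rightarrow> real) \<Rightarrow> nat \<Rightarrow> (nat \<Rightarrow> 'a) \<Rightarrow> real" where
  "min_separation d n x = Min {d (x i) (x j) | i j. 1 \<le> i \<and> i < j \<and> j \<le> n}"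

text \<open>Thickness refers to subsets of the positive integers.\<close>

definition thick :: "nat set \<Rightarrow> bool" where
  "thick F \<longleftrightarrow> F \<subseteq> {1..} \<and> (\<forall>L\<ge>1. \<exists>m\<ge>1. {m..m + L} \<subseteq> F)"

definition tuplewise_thickly_sensitive ::
    "nat \<Rightarrow> 'a set \<Rightarrow> ('a \<Rightarrow> 'a \<Rightarrow> real) \<Rightarrow> ('a \<Rightarrow> 'a) \<Rightarrow> bool" where
  "tuplewise_thickly_sensitive n M d T \<longleftrightarrow>
     (\<exists>\<delta>>0. \<forall>U. openin (Metric_space.mtopology M d) U \<and> U \<noteq> {} \<longrightarrow>
       (\<exists>x \<in> {1..n} \<rightarrow>\<^sub>E U.
          thick {k. 1 \<le> k \<and> min_separation d n (\<lambda>i. (T ^^ k) (x i)) > \<delta>}))"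

end

theory Submission imports Defs begin

text \<open>
  If \<open>x\<close> is proximal to a tuple \<open>y\<close> whose orbit stays separated, uniform continuity of the first \<open>L\<close>
  iterates keeps \<open>x\<close> separated for \<open>L\<close> consecutive times, at the cost of a smaller constant. Conversely,
  if \<open>x\<close> is separated along a thick set of times, compactness of the product yields a non-empty closed
  invariant set of tuples in the orbit closure of \<open>x\<close> all of whose iterates are separated; the
  Auslander--Ellis theorem, applied to a minimal subset \<open>B\<close> of it, gives a point of \<open>B\<close> proximal to \<open>x\<close>.
  That theorem is proved with the Ellis semigroup \<open>E\<close>: the elements of \<open>E\<close> sending \<open>x\<close> into \<open>B\<close> form a
  closed subsemigroup, which has an idempotent \<open>u\<close>, and \<open>u x = u (u x)\<close> makes \<open>x\<close> and \<open>u x\<close> proximal.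
\<close>

section \<open>Minimal closed sets and idempotents in compact semigroups\<close>

text \<open>Zorn's lemma for reverse inclusion; compactness keeps the intersection of a chain
  non-empty. The property \<open>P\<close> is left abstract because the result serves twice: for
  closed subsemigroups and for closed invariant sets.\<close>

lemma minimal_closed_subset_exists:
  assumes "compact_space X" and A: "closedin X A" "A \<noteq> {}" "P A"
    and Inter: "\<And>\<C>. \<C> \<noteq> {} \<Longrightarrow> (\<And>C. C \<in> \<C> \<Longrightarrow> P C) \<Longrightarrow> P (\<Inter>\<C>)"
  obtains B where "closedin X B" "B \<noteq> {}" "P B" "B \<subseteq> A"
    "\<And>C. \<lbrakk>closedin X C; C \<noteq> {}; P C; C \<subseteq> B\<rbrakk> \<Longrightarrow> C = B"
proof -
  define \<F> where "\<F> = {C. closedin X C \<and> C \<noteq> {} \<and> P C \<and> C \<subseteq> A}"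
  \<comment> \<open>Passing to complements turns the maximal element supplied by Zorn's lemma into a
    minimal closed set.\<close>
  define \<A> where "\<A> = uminus ` \<F>"
  have "\<exists>K\<in>\<A>. \<forall>Y\<in>\<A>. K \<subseteq> Y \<longrightarrow> Y = K"
  proof (rule subset_Zorn_nonempty)
    show "\<A> \<noteq> {}" using A by (auto simp: \<A>_def \<F>_def)
  next
    fix \<C> assume ne: "\<C> \<noteq> {}" and ch: "subset.chain \<A> \<C>"
    define \<G> where "\<G> = uminus ` \<C>"
    have sub: "\<G> \<subseteq> \<F>" using ch by (auto simp: \<G>_def \<A>_def subset_chain_def)
    have tot: "C \<subseteq> C' \<or> C' \<subseteq> C" if "C \<in> \<G>" "C' \<in> \<G>" for C C'
      using that ch by (auto simp: \<G>_def subset_chain_def)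
    have neG: "\<G> \<noteq> {}" using ne by (simp add: \<G>_def)
    \<comment> \<open>In a chain, a finite non-empty intersection is one of the members, hence
      non-empty. This is the finite intersection property needed for compactness.\<close>
    have fin: "finite \<U> \<Longrightarrow> \<U> \<noteq> {} \<Longrightarrow> \<U> \<subseteq> \<G> \<Longrightarrow> \<Inter>\<U> \<in> \<G>" for \<U>
    proof (induction \<U> rule: finite_ne_induct)
      case (insert C \<U>)
      then have "\<Inter>\<U> \<in> \<G>" "C \<in> \<G>" by auto
      then have "C \<inter> \<Inter>\<U> = C \<or> C \<inter> \<Inter>\<U> = \<Inter>\<U>" using tot [of C "\<Inter>\<U>"] by blast
      with \<open>\<Inter>\<U> \<in> \<G>\<close> \<open>C \<in> \<G>\<close> show ?case by auto
    qed auto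
    have "\<Inter>\<G> \<noteq> {}"
    proof -
      have "\<forall>C\<in>\<G>. closedin X C" using sub by (auto simp: \<F>_def)
      moreover have "\<Inter>\<U> \<noteq> {}" if "finite \<U>" "\<U> \<subseteq> \<G>" for \<U>
      proof (cases "\<U> = {}")
        case False
        with fin [OF that(1) _ that(2)] sub show ?thesis by (auto simp: \<F>_def)
      qed simp
      ultimately show ?thesis
        using \<open>compact_space X\<close> [unfolded compact_space_fip, rule_format, of \<G>] by blast
    qed
    moreover have "P (\<Inter>\<G>)" using Inter [OF neG] sub by (auto simp: \<F>_def)
    moreover have "closedin X (\<Inter>\<G>)" using neG sub by (auto simp: \<F>_def)
    moreover have "\<Inter>\<G> \<subseteq> A" using neG sub by (auto simp: \<F>_def)
    ultimately have "\<Inter>\<G> \<in> \<F>" by (simp add: \<F>_def)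
    moreover have "\<Union>\<C> = - \<Inter>\<G>" by (auto simp: \<G>_def)
    ultimately show "\<Union>\<C> \<in> \<A>" by (auto simp: \<A>_def)
  qed
  then obtain B where B: "B \<in> \<F>" and min: "\<And>C. C \<in> \<F> \<Longrightarrow> C \<subseteq> B \<Longrightarrow> C = B"
    unfolding \<A>_def by fastforce
  show thesis
  proof (rule that [of B])
    fix C assume "closedin X C" "C \<noteq> {}" "P C" "C \<subseteq> B"
    then show "C = B" using B min [of C] by (auto simp: \<F>_def)
  qed (use B in \<open>auto simp: \<F>_def\<close>)
qed

text \<open>Take a minimal closed subsemigroup \<open>B\<close> and \<open>u\<close> in it. The set
  \<open>B u\<close> is a closed subsemigroup of \<open>B\<close>, so it equals \<open>B\<close> and
  some \<open>q\<close> satisfies \<open>q u = u\<close>. Hence the solutions \<open>p\<close> of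
  \<open>p u = u\<close> form a non-empty closed subsemigroup, which is again \<open>B\<close> and
  so contains \<open>u\<close>. Continuity is asked in the left factor only, since this is what
  composition of arbitrary maps offers.\<close>

lemma ellis_numakura:
  assumes "compact_space X" "Hausdorff_space X"
    and L: "closedin X L" "L \<noteq> {}"
    and closed: "\<And>p q. p \<in> L \<Longrightarrow> q \<in> L \<Longrightarrow> m p q \<in> L"
    and assoc: "\<And>p q r. p \<in> L \<Longrightarrow> q \<in> L \<Longrightarrow> r \<in> L \<Longrightarrow> m (m p q) r = m p (m q r)"
    and cont: "\<And>q. q \<in> L \<Longrightarrow> continuous_map X X (\<lambda>p. m p q)"
  obtains u where "u \<in> L" "m u u = u"
proof -
  obtain B where B: "closedin X B" "B \<noteq> {}" "B \<subseteq> L"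
    and mB: "\<And>p q. p \<in> B \<Longrightarrow> q \<in> B \<Longrightarrow> m p q \<in> B"
    and min: "\<And>C. \<lbrakk>closedin X C; C \<noteq> {}; \<forall>p\<in>C. \<forall>q\<in>C. m p q \<in> C; C \<subseteq> B\<rbrakk> \<Longrightarrow> C = B"
    by (rule minimal_closed_subset_exists [OF \<open>compact_space X\<close> L,
          of "\<lambda>C. \<forall>p\<in>C. \<forall>q\<in>C. m p q \<in> C"]) (use closed in auto)
  obtain u where u: "u \<in> B" using B by blast
  have BL: "p \<in> L" if "p \<in> B" for p using that B by blast
  have cu: "continuous_map X X (\<lambda>p. m p u)" using cont BL u by blast
  have "(\<lambda>p. m p u) ` B = B"
  proof (rule min)
    show "closedin X ((\<lambda>p. m p u) ` B)"
      using \<open>Hausdorff_space X\<close> image_compactin [OF closedin_compact_space [OF \<open>compact_space X\<close> B(1)] cu]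
      by (rule compactin_imp_closedin)
    show "\<forall>p\<in>(\<lambda>p. m p u) ` B. \<forall>q\<in>(\<lambda>p. m p u) ` B. m p q \<in> (\<lambda>p. m p u) ` B"
    proof clarify
      fix p q assume "p \<in> B" "q \<in> B"
      then have "m (m p u) (m q u) = m (m (m p u) q) u" using assoc BL mB u by metis
      with \<open>p \<in> B\<close> \<open>q \<in> B\<close> mB u show "m (m p u) (m q u) \<in> (\<lambda>p. m p u) ` B" by blast
    qed
  qed (use B mB u in auto)
  then obtain q where q: "q \<in> B" "m q u = u" using u by (metis imageE)
  have "{p \<in> B. m p u = u} = B"
  proof (rule min)
    have "closedin X {u}"
      using u B \<open>Hausdorff_space X\<close> closedin_subset by (metis closedin_Hausdorff_singleton subsetD)
    then show "closedin X {p \<in> B. m p u = u}"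
      using closedin_continuous_map_preimage_gen [OF cu B(1), of "{u}"] by simp
    show "\<forall>p\<in>{p \<in> B. m p u = u}. \<forall>q\<in>{p \<in> B. m p u = u}. m p q \<in> {p \<in> B. m p u = u}"
      using assoc BL mB u by auto
  qed (use q in auto)
  with u that BL show thesis by blast
qed

section \<open>The Auslander-Ellis theorem via the Ellis semigroup\<close>

lemma continuous_map_funpow:
  "continuous_map X X f \<Longrightarrow> continuous_map X X (f ^^ k)"
  by (induction k) (auto simp: id_def intro: continuous_map_compose)

text \<open>Proximality appears in topological form: the orbits of \<open>x\<close> and
  \<open>y\<close> meet every neighbourhood of \<open>y\<close> at a common time. In a metric space,
  small balls around \<open>y\<close> turn this into small distances.\<close>

theorem auslander_ellis:
  assumes X: "compact_space X" "Hausdorff_space X" and S: "continuous_map X X S"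
    and x: "x \<in> topspace X"
    and A: "closedin X A" "A \<noteq> {}" "S ` A \<subseteq> A" "A \<subseteq> X closure_of range (\<lambda>k. (S ^^ k) x)"
  obtains y where "y \<in> A"
    "\<And>W. openin X W \<Longrightarrow> y \<in> W \<Longrightarrow> \<exists>k. (S ^^ k) x \<in> W \<and> (S ^^ k) y \<in> W"
proof -
  let ?T = "topspace X"
  \<comment> \<open>\<open>F\<close> carries the topology of pointwise convergence on all self-maps
    of the space, continuous or not. Restriction makes the iterates points of this product, and
    \<open>E\<close> is the Ellis semigroup.\<close>
  define F where "F = product_topology (\<lambda>_. X) ?T"
  define e where "e k = restrict (S ^^ k) ?T" for k
  define E where "E = F closure_of range e"
  have topF: "topspace F = ?T \<rightarrow>\<^sub>E ?T" by (simp add: F_def)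
  have F: "compact_space F" "Hausdorff_space F"
    using X by (simp_all add: F_def compact_space_product_topology Hausdorff_space_product_topology)
  have Sk: "continuous_map X X (S ^^ k)" for k by (rule continuous_map_funpow [OF S])
  have SkT: "(S ^^ k) z \<in> ?T" if "z \<in> ?T" for k z
    using Sk that by (metis continuous_map_image_subset_topspace image_subset_iff)
  have e: "e k \<in> topspace F" for k by (auto simp: topF e_def SkT)
  have clE: "closedin F E" by (simp add: E_def)
  have EF: "p \<in> ?T \<rightarrow>\<^sub>E ?T" if "p \<in> E" for p
    using that topF by (simp add: E_def in_closure_of)
  have eE: "e k \<in> E" for k using e by (auto simp: E_def in_closure_of)
  have eval: "continuous_map F X (\<lambda>p. p z)" if "z \<in> ?T" for z
    unfolding F_def using that by (rule continuous_map_product_coordinates)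
  \<comment> \<open>The coordinate of \<open>p\<close> after \<open>q\<close> at \<open>z\<close> is
    the coordinate of \<open>p\<close> at \<open>q z\<close>; so continuity in \<open>p\<close>
    holds even for discontinuous \<open>q\<close>.\<close>
  have comp_left: "continuous_map F F (\<lambda>p. compose ?T p q)" if "q \<in> ?T \<rightarrow>\<^sub>E ?T" for q
  proof -
    have "continuous_map F X (\<lambda>p. compose ?T p q z)" if "z \<in> ?T" for z
      using eval [of "q z"] that \<open>q \<in> _\<close> by (simp add: compose_eq PiE_iff)
    then show ?thesis
      by (subst (2) F_def) (auto simp: continuous_map_componentwise compose_def)
  qed
  \<comment> \<open>Elements of \<open>E\<close> may be discontinuous, but the iterates are
    continuous, so with an iterate on the left the right factor may vary.\<close>
  have comp_right: "continuous_map F F (\<lambda>p. compose ?T (e k) p)" for k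
  proof -
    have "continuous_map F X (\<lambda>p. compose ?T (e k) p z)" if "z \<in> ?T" for z
    proof (rule continuous_map_eq)
      show "continuous_map F X ((S ^^ k) \<circ> (\<lambda>p. p z))"
        using eval [OF that] Sk by (rule continuous_map_compose)
    qed (use that in \<open>auto simp: topF compose_eq e_def PiE_iff\<close>)
    then show ?thesis
      by (subst (2) F_def) (auto simp: continuous_map_componentwise compose_def)
  qed
  have ee: "compose ?T (e j) (e k) = e (j + k)" for j k
    by (auto simp: compose_def e_def fun_eq_iff SkT funpow_add)
  \<comment> \<open>Closure of \<open>E\<close> under composition is reached in two stages: first an
    iterate on the left and a limit on the right, then, in \<open>compE\<close>, a limit on the left
    with the right factor fixed.\<close>
  have eq: "compose ?T (e k) q \<in> E" if "q \<in> E" for k q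
  proof -
    have "compose ?T (e k) q \<in> F closure_of (compose ?T (e k) ` range e)"
      using continuous_map_image_closure_subset [OF comp_right] that unfolding E_def by blast
    also have "\<dots> \<subseteq> E" unfolding E_def by (rule closure_of_mono) (auto simp: ee)
    finally show ?thesis .
  qed
  have compE: "compose ?T p q \<in> E" if "p \<in> E" "q \<in> E" for p q
  proof -
    have "compose ?T p q \<in> F closure_of ((\<lambda>p. compose ?T p q) ` range e)"
      using continuous_map_image_closure_subset [OF comp_left [OF EF [OF \<open>q \<in> E\<close>]]] that
      unfolding E_def by blast
    also have "\<dots> \<subseteq> E" by (rule closure_of_minimal) (use eq [OF that(2)] clE in auto)
    finally show ?thesis .
  qed
  have AT: "z \<in> ?T" if "z \<in> A" for z using that A(1) closedin_subset by blast
  have SA: "(S ^^ k) z \<in> A" if "z \<in> A" for k z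
    using that A(3) by (induction k) (auto simp: image_subset_iff)
  have EA: "p z \<in> A" if "p \<in> E" "z \<in> A" for p z
  proof -
    have "(\<lambda>p. p z) ` E \<subseteq> X closure_of ((\<lambda>p. p z) ` range e)"
      unfolding E_def by (intro continuous_map_image_closure_subset eval AT that)
    also have "\<dots> \<subseteq> A"
      by (rule closure_of_minimal) (use A(1) SA AT that(2) in \<open>auto simp: e_def\<close>)
    finally show ?thesis using that by blast
  qed
  define L where "L = {p \<in> E. p x \<in> A}"
  \<comment> \<open>Evaluation at \<open>x\<close> maps the compact set \<open>E\<close> onto a
    closed set containing the orbit of \<open>x\<close>, hence the orbit closure and
    \<open>A\<close>. This makes \<open>L\<close> non-empty.\<close>
  have "closedin X ((\<lambda>p. p x) ` E)"
    using X(2) image_compactin [OF closedin_compact_space [OF F(1) clE] eval [OF x]]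
    by (rule compactin_imp_closedin)
  moreover have "(S ^^ k) x \<in> (\<lambda>p. p x) ` E" for k
    using eE [of k] x by (intro image_eqI [of _ _ "e k"]) (auto simp: e_def)
  ultimately have "X closure_of range (\<lambda>k. (S ^^ k) x) \<subseteq> (\<lambda>p. p x) ` E"
    by (intro closure_of_minimal) auto
  with A(4) have "A \<subseteq> (\<lambda>p. p x) ` E" by (rule subset_trans)
  with A(2) have Lne: "L \<noteq> {}" unfolding L_def by blast
  have L: "closedin F L"
    unfolding L_def by (rule closedin_continuous_map_preimage_gen [OF eval [OF x] clE A(1)])
  have LL: "compose ?T p q \<in> L" if "p \<in> L" "q \<in> L" for p q
      using that compE EA x by (auto simp: L_def compose_eq)
  have Lass: "compose ?T (compose ?T p q) r = compose ?T p (compose ?T q r)"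
      if "p \<in> L" "q \<in> L" "r \<in> L" for p q r
      using that EF unfolding L_def by (intro compose_assoc [symmetric, of _ _ ?T]) (auto simp: PiE_iff)
  have Lcont: "continuous_map F F (\<lambda>p. compose ?T p q)" if "q \<in> L" for q
    using that EF by (intro comp_left) (auto simp: L_def)
  obtain u where u: "u \<in> L" "compose ?T u u = u"
    using ellis_numakura [OF F L Lne LL Lass Lcont] .
  have uu: "u (u x) = u x" using u(2) x by (metis compose_eq)
  show thesis
  proof (rule that [of "u x"])
    show "u x \<in> A" using u(1) by (simp add: L_def)
    then have uxT: "u x \<in> ?T" by (rule AT)
    fix W assume W: "openin X W" "u x \<in> W"
    \<comment> \<open>A neighbourhood of \<open>u\<close> that constrains the two coordinates
      \<open>x\<close> and \<open>u x\<close>; idempotence puts \<open>u\<close> in it. An iterate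
      in \<open>V\<close> then brings \<open>x\<close> and \<open>u x\<close> into \<open>W\<close>
      at the same time.\<close>
    define V where "V = {p \<in> topspace F. p x \<in> W} \<inter> {p \<in> topspace F. p (u x) \<in> W}"
    have "openin F V"
      unfolding V_def using W(1) x uxT
      by (intro openin_Int openin_continuous_map_preimage [OF eval])
    moreover have "u \<in> V" using u(1) EF W(2) uu by (simp add: V_def topF L_def)
    moreover have "u \<in> F closure_of range e" using u(1) by (simp add: L_def E_def)
    ultimately obtain k where "e k \<in> V" by (auto simp: in_closure_of)
    then show "\<exists>k. (S ^^ k) x \<in> W \<and> (S ^^ k) (u x) \<in> W"
      using x uxT by (auto simp: V_def e_def)
  qed
qed

section \<open>Uniform continuity and proximality\<close>

lemma (in Metric_space12) compact_imp_uniformly_continuous_family: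
  assumes "compact_space M1.mtopology" "finite K"
    and f: "\<And>k. k \<in> K \<Longrightarrow> continuous_map M1.mtopology M2.mtopology (f k)" and "\<eta> > 0"
  obtains \<epsilon> where "\<epsilon> > 0"
    "\<And>a b k. \<lbrakk>a \<in> M1; b \<in> M1; d1 a b < \<epsilon>; k \<in> K\<rbrakk> \<Longrightarrow> d2 (f k a) (f k b) < \<eta>"
proof -
  have one: "\<exists>\<epsilon>>0. \<forall>a\<in>M1. \<forall>b\<in>M1. d1 a b < \<epsilon> \<longrightarrow> d2 (g a) (g b) < \<eta>"
    if g: "continuous_map M1.mtopology M2.mtopology g" for g
  proof -
    have gM: "g a \<in> M2" if "a \<in> M1" for a
      using g that continuous_map_image_subset_topspace by fastforce
    \<comment> \<open>A Lebesgue number of the cover by preimages of balls of radius \<eta>/2 works: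
      two points in one such preimage have images within \<eta>, by way of the centre.\<close>
    define U where "U a = {b \<in> M1. g b \<in> M2.mball (g a) (\<eta>/2)}" for a
    have "compactin M1.mtopology M1" using assms(1) by (simp add: compact_space_def)
    moreover have "M1 \<subseteq> \<Union>(U ` M1)" using gM \<open>\<eta> > 0\<close> by (auto simp: U_def)
    moreover have "openin M1.mtopology V" if "V \<in> U ` M1" for V
    proof -
      obtain a where "V = U a" using \<open>V \<in> U ` M1\<close> by blast
      with openin_continuous_map_preimage [OF g M2.openin_mball, of "g a" "\<eta>/2"]
      show ?thesis by (simp only: U_def M1.topspace_mtopology)
    qed
    ultimately obtain \<epsilon> where \<epsilon>: "\<epsilon> > 0" "\<forall>a\<in>M1. \<exists>V\<in>U ` M1. M1.mball a \<epsilon> \<subseteq> V"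
      using M1.lebesgue_number by meson
    have "d2 (g a) (g b) < \<eta>" if ab: "a \<in> M1" "b \<in> M1" "d1 a b < \<epsilon>" for a b
    proof -
      obtain c where c: "c \<in> M1" "M1.mball a \<epsilon> \<subseteq> U c" using \<epsilon>(2) ab(1) by blast
      have "a \<in> U c" "b \<in> U c" using c(2) ab \<epsilon>(1) by auto
      then have "d2 (g c) (g a) < \<eta>/2" "d2 (g c) (g b) < \<eta>/2" by (auto simp: U_def)
      then show ?thesis
        using M2.triangle [of "g a" "g c" "g b"] M2.commute [of "g a" "g c"] gM ab c(1) by simp
    qed
    with \<epsilon>(1) show ?thesis by blast
  qed
  have "\<exists>\<epsilon>>0. \<forall>a\<in>M1. \<forall>b\<in>M1. d1 a b < \<epsilon> \<longrightarrow> (\<forall>k\<in>K. d2 (f k a) (f k b) < \<eta>)"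
    using \<open>finite K\<close> f
  proof (induction K)
    case empty
    show ?case by (auto intro: exI [of _ 1])
  next
    case (insert k K)
    then obtain \<epsilon>1 where 1: "\<epsilon>1 > 0"
      "\<forall>a\<in>M1. \<forall>b\<in>M1. d1 a b < \<epsilon>1 \<longrightarrow> (\<forall>k\<in>K. d2 (f k a) (f k b) < \<eta>)"
      by auto
    obtain \<epsilon>2 where 2: "\<epsilon>2 > 0" "\<forall>a\<in>M1. \<forall>b\<in>M1. d1 a b < \<epsilon>2 \<longrightarrow> d2 (f k a) (f k b) < \<eta>"
      using one insert.prems by blast
    show ?case
      by (rule exI [of _ "min \<epsilon>1 \<epsilon>2"]) (use 1 2 in auto)
  qed
  with that show thesis by blast
qed

text \<open>Distances are nonnegative, so the lower limit vanishes unless it is positive, and it is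
  positive exactly when a positive real eventually bounds the distances from below.\<close>

lemma (in Metric_space) proximal_iff_frequently:
  "proximal d S x y \<longleftrightarrow> (\<forall>\<epsilon>>0. \<forall>K. \<exists>k\<ge>K. d ((S ^^ k) x) ((S ^^ k) y) < \<epsilon>)"
proof -
  define X where "X k = ereal (d ((S ^^ k) x) ((S ^^ k) y))" for k
  have "0 \<le> liminf X" by (rule Liminf_bounded) (simp add: X_def)
  then have "proximal d S x y \<longleftrightarrow> \<not> 0 < liminf X"
    by (auto simp: proximal_def X_def [symmetric])
  also have "\<dots> \<longleftrightarrow> \<not> (\<exists>\<epsilon>>0. \<exists>K. \<forall>k\<ge>K. \<not> d ((S ^^ k) x) ((S ^^ k) y) < \<epsilon>)"
  proof (rule arg_cong [where f = Not], rule iffI)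
    assume "0 < liminf X"
    then obtain \<epsilon> where \<epsilon>: "0 < ereal \<epsilon>" "ereal \<epsilon> < liminf X" using ereal_dense2 by blast
    then have "eventually (\<lambda>k. ereal \<epsilon> < X k) sequentially"
      using le_Liminf_iff [of "liminf X" sequentially X] by blast
    then obtain K where "\<forall>k\<ge>K. \<epsilon> < d ((S ^^ k) x) ((S ^^ k) y)"
      by (auto simp: eventually_sequentially X_def)
    with \<epsilon>(1) show "\<exists>\<epsilon>>0. \<exists>K. \<forall>k\<ge>K. \<not> d ((S ^^ k) x) ((S ^^ k) y) < \<epsilon>"
      by (intro exI [of _ \<epsilon>]) (auto simp: not_less intro: exI [of _ K] less_imp_le)
  next
    assume "\<exists>\<epsilon>>0. \<exists>K. \<forall>k\<ge>K. \<not> d ((S ^^ k) x) ((S ^^ k) y) < \<epsilon>"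
    then obtain \<epsilon> K where \<epsilon>: "\<epsilon> > 0" "\<forall>k\<ge>K. \<epsilon> \<le> d ((S ^^ k) x) ((S ^^ k) y)"
      by (auto simp: not_less)
    then have "ereal \<epsilon> \<le> liminf X"
      by (intro Liminf_bounded) (auto simp: eventually_sequentially X_def)
    with \<epsilon>(1) show "0 < liminf X" by (metis ereal_less(2) less_le_trans)
  qed
  finally show ?thesis by blast
qed

text \<open>
  A single approach time for each \<open>\<epsilon>\<close> suffices: either the orbits merge, or the finitely many
  distances before time \<open>K\<close> have a positive minimum.
\<close>

lemma (in Metric_space) proximalI:
  assumes "S ` M \<subseteq> M" "x \<in> M" "y \<in> M"
    and close: "\<And>\<epsilon>. \<epsilon> > 0 \<Longrightarrow> \<exists>k. d ((S ^^ k) x) ((S ^^ k) y) < \<epsilon>"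
  shows "proximal d S x y"
  unfolding proximal_iff_frequently
proof (intro allI impI)
  fix \<epsilon> :: real and K :: nat assume "\<epsilon> > 0"
  let ?X = "\<lambda>k. d ((S ^^ k) x) ((S ^^ k) y)"
  have SM: "(S ^^ k) z \<in> M" if "z \<in> M" for k z
    using that assms(1) by (induction k) auto
  show "\<exists>k\<ge>K. ?X k < \<epsilon>"
  proof (cases "\<exists>k<K. ?X k = 0")
    case True
    then obtain k where k: "k < K" "(S ^^ k) x = (S ^^ k) y" using SM assms by auto
    then have "(S ^^ (K - k + k)) x = (S ^^ (K - k + k)) y" by (simp only: funpow_add o_apply)
    then have "?X K = 0" using k(1) SM assms by simp
    with \<open>\<epsilon> > 0\<close> show ?thesis by force
  next
    case False
    define \<epsilon>' where "\<epsilon>' = Min (insert \<epsilon> (?X ` {..<K}))"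
    have "?X k > 0" if "k < K" for k
      using False that nonneg [of "(S ^^ k) x" "(S ^^ k) y"] by (metis order_less_le)
    then have "\<epsilon>' > 0" using \<open>\<epsilon> > 0\<close> by (simp add: \<epsilon>'_def)
    then obtain k where k: "?X k < \<epsilon>'" using close by blast
    then have "?X k < \<epsilon>" "K \<le> k" by (auto simp: \<epsilon>'_def not_less)
    then show ?thesis by blast
  qed
qed

section \<open>Separation of tuples, orbits in the product, minimal points\<close>

text \<open>For \<open>n \<ge> 2\<close> the pair \<open>(1, 2)\<close> makes the set under
  \<open>Min\<close> non-empty. The strict form is for thick sets of times, the weak one for closed
  conditions.\<close>

lemma min_separation_ge_iff:
  assumes "n \<ge> 2"
  shows "c \<le> min_separation d n x \<longleftrightarrow> (\<forall>i j. 1 \<le> i \<and> i < j \<and> j \<le> n \<longrightarrow> c \<le> d (x i) (x j))"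
    and "c < min_separation d n x \<longleftrightarrow> (\<forall>i j. 1 \<le> i \<and> i < j \<and> j \<le> n \<longrightarrow> c < d (x i) (x j))"
proof -
  let ?A = "{d (x i) (x j) | i j. 1 \<le> i \<and> i < j \<and> j \<le> n}"
  have "?A \<subseteq> (\<lambda>(i, j). d (x i) (x j)) ` ({..n} \<times> {..n})" by fastforce
  then have "finite ?A" by (rule finite_subset) auto
  moreover have "d (x 1) (x 2) \<in> ?A" using assms by force
  then have "?A \<noteq> {}" by blast
  ultimately show
    "c \<le> min_separation d n x \<longleftrightarrow> (\<forall>i j. 1 \<le> i \<and> i < j \<and> j \<le> n \<longrightarrow> c \<le> d (x i) (x j))"
    "c < min_separation d n x \<longleftrightarrow> (\<forall>i j. 1 \<le> i \<and> i < j \<and> j \<le> n \<longrightarrow> c < d (x i) (x j))"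
    unfolding min_separation_def by (auto simp: Min_ge_iff Min_gr_iff)
qed

lemma min_separation_cong:
  assumes "\<And>i. i \<in> {1..n} \<Longrightarrow> x i = y i"
  shows "min_separation d n x = min_separation d n y"
proof -
  have "d (x i) (x j) = d (y i) (y j)" if "1 \<le> i \<and> i < j \<and> j \<le> n" for i j
    using that assms [of i] assms [of j] by simp
  then have "{d (x i) (x j) | i j. 1 \<le> i \<and> i < j \<and> j \<le> n} =
      {d (y i) (y j) | i j. 1 \<le> i \<and> i < j \<and> j \<le> n}"
    by (intro Collect_cong) metis
  then show ?thesis by (simp add: min_separation_def)
qed

text \<open>The set is the intersection, over pairs of indices, of preimages of \<open>{c..}\<close>
  under the continuous distance between two coordinates.\<close>

lemma (in Metric_space) closedin_min_separation:
  assumes "n \<ge> 2"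
  shows "closedin (product_topology (\<lambda>_. mtopology) {1..n})
      {z \<in> {1..n} \<rightarrow>\<^sub>E M. c \<le> min_separation d n z}"
proof -
  let ?P = "product_topology (\<lambda>_. mtopology) {1..n}"
  define K where "K = {(i, j). 1 \<le> i \<and> i < j \<and> j \<le> n}"
  define C where "C p = {z \<in> topspace ?P. d (z (fst p)) (z (snd p)) \<in> {c..}}" for p
  have "closedin ?P (C p)" if "p \<in> K" for p
    unfolding C_def
  proof (rule closedin_continuous_map_preimage)
    have "continuous_map ?P (mtopology_of (metric (M, d))) (\<lambda>z. z i)" if "i \<in> {1..n}" for i
      using continuous_map_product_coordinates [OF that, of "\<lambda>_. mtopology"]
      by (simp add: mtopology_of_def)
    from continuous_map_mdist [OF this this]
    show "continuous_map ?P euclideanreal (\<lambda>z. d (z (fst p)) (z (snd p)))"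
      using \<open>p \<in> K\<close> by (auto simp: K_def)
  qed simp
  moreover have "(1, 2) \<in> K" using assms by (simp add: K_def)
  ultimately have "closedin ?P (\<Inter>(C ` K))" by (intro closedin_Inter) auto
  moreover have "{z \<in> {1..n} \<rightarrow>\<^sub>E M. c \<le> min_separation d n z} = \<Inter>(C ` K)"
    using \<open>(1, 2) \<in> K\<close> by (auto simp: min_separation_ge_iff [OF assms] C_def K_def)
  ultimately show ?thesis by simp
qed

text \<open>Extensionality matters at \<open>k = 0\<close>, where the left side is \<open>z\<close>
  itself and the right side is a restriction.\<close>

lemma product_map_funpow:
  "z \<in> extensional {1..n} \<Longrightarrow> (product_map n T ^^ k) z = (\<lambda>i\<in>{1..n}. (T ^^ k) (z i))"
  by (induction k) (auto simp: product_map_def extensional_restrict)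

text \<open>The orbit closure of \<open>y\<close> is a non-empty closed invariant subset of
  \<open>B\<close>, hence all of \<open>B\<close>.\<close>

lemma (in Metric_space) minimal_pointI:
  assumes S: "continuous_map mtopology mtopology S"
    and B: "closedin mtopology B" "S ` B \<subseteq> B" "y \<in> B"
    and min: "\<And>C. \<lbrakk>closedin mtopology C; C \<noteq> {}; S ` C \<subseteq> C; C \<subseteq> B\<rbrakk> \<Longrightarrow> C = B"
  shows "minimal_point M d S y"
proof -
  have BM: "B \<subseteq> M" using B(1) closedin_subset by fastforce
  define Q where "Q = range (\<lambda>k. (S ^^ k) y)"
  have "(S ^^ k) y \<in> B" for k using B(2,3) by (induction k) auto
  then have QB: "Q \<subseteq> B" by (auto simp: Q_def)
  have "S ` Q \<subseteq> Q"
    unfolding Q_def by (force intro: range_eqI [of _ _ "Suc k" for k])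
  then have inv: "S ` (mtopology closure_of Q) \<subseteq> mtopology closure_of Q"
    using continuous_map_image_closure_subset [OF S] closure_of_mono by blast
  have "mtopology closure_of Q = B"
  proof (rule min)
    have "Q \<subseteq> topspace mtopology" using QB BM by auto
    then have "Q \<subseteq> mtopology closure_of Q" by (rule closure_of_subset)
    then show "mtopology closure_of Q \<noteq> {}" by (auto simp: Q_def)
    show "mtopology closure_of Q \<subseteq> B" by (rule closure_of_minimal [OF QB B(1)])
  qed (use inv in auto)
  then have orb: "orbit_closure M d S y = B" by (simp add: orbit_closure_def Q_def)
  \<comment> \<open>Since \<open>B\<close> is closed, sets closed in the subspace \<open>B\<close>
    are closed in \<open>M\<close>, so \<open>min\<close> applies to every subsystem of
    \<open>B\<close>.\<close>
  interpret Submetric M d B using BM by unfold_locales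
  have "minimal_system B d S"
    unfolding minimal_system_def subsystem_def mtopology_submetric
    using min B(1) by (meson closedin_imp_subset closedin_trans_full)
  moreover have "subsystem M d S B" using B by (auto simp: subsystem_def)
  ultimately show ?thesis using BM B(3) by (auto simp: minimal_point_def orb)
qed


section \<open>The cycle of implications between the three conditions\<close>

theorem proposition4p2:
  fixes M :: "'a set" and d :: "'a \<Rightarrow> 'a \<Rightarrow> real" and T :: "'a \<Rightarrow> 'a" and n :: nat
    and D :: "(nat \<Rightarrow> 'a) \<Rightarrow> (nat \<Rightarrow> 'a) \<Rightarrow> real"
  assumes "dynamical_system M d T"
    and "n \<ge> 2"
    and "compatible_product_metric n M d D"
  shows "(tuplewise_thickly_sensitive n M d T \<longleftrightarrow>
      (\<exists>\<delta>>0::real. \<forall>U. openin (Metric_space.mtopology M d) U \<and> U \<noteq> {} \<longrightarrow>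
        (\<exists>x \<in> {1..n} \<rightarrow>\<^sub>E U. \<exists>y \<in> {1..n} \<rightarrow>\<^sub>E M.
          proximal D (product_map n T) x y \<and>
          liminf (\<lambda>m. ereal (min_separation d n (\<lambda>i. (T ^^ m) (y i)))) \<ge> ereal \<delta>)))
    \<and> (tuplewise_thickly_sensitive n M d T \<longleftrightarrow>
      (\<exists>\<delta>>0::real. \<forall>U. openin (Metric_space.mtopology M d) U \<and> U \<noteq> {} \<longrightarrow>
        (\<exists>x \<in> {1..n} \<rightarrow>\<^sub>E U. \<exists>y \<in> {1..n} \<rightarrow>\<^sub>E M.
          minimal_point ({1..n} \<rightarrow>\<^sub>E M) D (product_map n T) y \<and>
          proximal D (product_map n T) x y \<and>
          liminf (\<lambda>m. ereal (min_separation d n (\<lambda>i. (T ^^ m) (y i)))) \<ge> ereal \<delta>)))"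
proof -
  note One_nat_def [simp del]
  let ?N = "{1..n} \<rightarrow>\<^sub>E M"
  let ?S = "product_map n T"
  define sep where "sep z k = min_separation d n (\<lambda>i. (T ^^ k) (z i))" for z k
  let ?far = "\<lambda>\<delta> y. liminf (\<lambda>m. ereal (sep y m)) \<ge> ereal \<delta>"
  interpret Md: Metric_space M d using assms(1) by (simp add: dynamical_system_def)
  interpret ND: Metric_space ?N D using assms(3) by (simp add: compatible_product_metric_def)
  interpret P: Metric_space12 ?N D M d by unfold_locales
  have top: "ND.mtopology = product_topology (\<lambda>_. Md.mtopology) {1..n}"
    using assms(3) by (simp add: compatible_product_metric_def)
  have T: "continuous_map Md.mtopology Md.mtopology T" and cM: "compact_space Md.mtopology"
    using assms(1) by (simp_all add: dynamical_system_def)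
  have cN: "compact_space ND.mtopology" using cM unfolding top compact_space_product_topology by blast
  have coord: "continuous_map ND.mtopology Md.mtopology (\<lambda>z. z i)" if "i \<in> {1..n}" for i
    unfolding top using that by (rule continuous_map_product_coordinates)
  have iter: "continuous_map ND.mtopology Md.mtopology (\<lambda>z. (T ^^ k) (z i))"
    if "i \<in> {1..n}" for k i
    using continuous_map_compose [OF coord [OF that] continuous_map_funpow [OF T, of k]]
    by (simp add: o_def)
  have S: "continuous_map ND.mtopology ND.mtopology ?S"
    using iter [of _ "Suc 0"] by (subst (2) top) (auto simp: continuous_map_componentwise product_map_def)
  then have SN: "?S ` ?N \<subseteq> ?N"
    using continuous_map_image_subset_topspace [OF S] by simp
  have SkN: "(?S ^^ k) z \<in> ?N" if "z \<in> ?N" for k z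
    using that SN by (induction k) (auto simp: image_subset_iff)
  have Sk: "(?S ^^ k) z = (\<lambda>i\<in>{1..n}. (T ^^ k) (z i))" if "z \<in> ?N" for k z
    using that by (intro product_map_funpow) (simp add: PiE_def)
  \<comment> \<open>This lets \<open>sep\<close> be read both coordinatewise, as in the theorem, and
    along an orbit of the product system.\<close>
  have sep: "sep z k = min_separation d n ((?S ^^ k) z)" if "z \<in> ?N" for z k
    unfolding sep_def by (rule min_separation_cong) (simp add: Sk [OF that])
  have sepS: "sep ((?S ^^ m) z) k = sep z (k + m)" if "z \<in> ?N" for m k z
    by (simp add: sep SkN that funpow_add)
  have sens: "tuplewise_thickly_sensitive n M d T \<longleftrightarrow>
      (\<exists>\<delta>>0. \<forall>U. openin Md.mtopology U \<and> U \<noteq> {} \<longrightarrow>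
        (\<exists>x\<in>{1..n} \<rightarrow>\<^sub>E U. thick {k. 1 \<le> k \<and> \<delta> < sep x k}))"
    by (simp add: tuplewise_thickly_sensitive_def sep_def)

  have thick_if_proximal: "thick {k. 1 \<le> k \<and> \<delta> / 2 < sep x k}"
    if "\<delta> > 0" and x: "x \<in> ?N" and y: "y \<in> ?N" and prox: "proximal D ?S x y" and far: "?far \<delta> y"
    for \<delta> x y
    unfolding thick_def
  proof (intro conjI allI impI)
    fix L :: nat assume "L \<ge> 1"
    \<comment> \<open>The lower limit only gives eventual bounds below \<delta>. Starting from
      3\<delta>/4 and losing \<delta>/8 at each of the two points leaves \<delta>/2.\<close>
    have "ereal (3/4 * \<delta>) < ereal \<delta>" using \<open>\<delta> > 0\<close> by simp
    then have "eventually (\<lambda>m. ereal (3/4 * \<delta>) < ereal (sep y m)) sequentially"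
      using far [unfolded le_Liminf_iff] by blast
    then obtain K where K: "3/4 * \<delta> < sep y m" if "m \<ge> K" for m
      by (auto simp: eventually_sequentially)
    \<comment> \<open>Indices are pairs of a time up to \<open>L\<close> and a coordinate, so that a
      single \<epsilon> serves the whole window.\<close>
    obtain \<epsilon> where "\<epsilon> > 0" and \<epsilon>: "\<And>a b k. \<lbrakk>a \<in> ?N; b \<in> ?N; D a b < \<epsilon>; k \<in> {..L} \<times> {1..n}\<rbrakk>
        \<Longrightarrow> d ((T ^^ fst k) (a (snd k))) ((T ^^ fst k) (b (snd k))) < \<delta>/8"
      by (rule P.compact_imp_uniformly_continuous_family [OF cN, of "{..L} \<times> {1..n}"
            "\<lambda>k z. (T ^^ fst k) (z (snd k))" "\<delta>/8"]) (use \<open>\<delta> > 0\<close> iter in auto)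
    \<comment> \<open>From time \<open>K\<close> on, \<open>y\<close> is separated; the bound 1 is
      there because thick sets consist of positive integers.\<close>
    obtain m where m: "m \<ge> max K 1" "D ((?S ^^ m) x) ((?S ^^ m) y) < \<epsilon>"
      using prox \<open>\<epsilon> > 0\<close> unfolding ND.proximal_iff_frequently by blast
    have "\<delta> / 2 < sep x (j + m)" if "j \<le> L" for j
    proof -
      let ?a = "\<lambda>i. (T ^^ j) ((?S ^^ m) x i)" and ?b = "\<lambda>i. (T ^^ j) ((?S ^^ m) y i)"
      have M: "?a i \<in> M" "?b i \<in> M" if "i \<in> {1..n}" for i
        using continuous_map_image_subset_topspace [OF iter [OF that, of j]] SkN [OF x] SkN [OF y]
        by (auto simp: image_subset_iff)
      have close: "d (?a i) (?b i) < \<delta>/8" if "i \<in> {1..n}" for i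
        using \<epsilon> [OF SkN [OF x] SkN [OF y] m(2), of "(j, i)"] that \<open>j \<le> L\<close> by simp
      have "3/4 * \<delta> < sep ((?S ^^ m) y) j" using K m(1) by (simp add: sepS y)
      then have fary: "3/4 * \<delta> < d (?b i) (?b i')" if "1 \<le> i \<and> i < i' \<and> i' \<le> n" for i i'
        using that unfolding sep_def min_separation_ge_iff(2) [OF assms(2)] by blast
      have "\<delta>/2 < d (?a i) (?a i')" if *: "1 \<le> i \<and> i < i' \<and> i' \<le> n" for i i'
      proof -
        have i: "i \<in> {1..n}" "i' \<in> {1..n}" using * by auto
        have "d (?b i) (?b i') \<le> d (?b i) (?a i) + d (?a i) (?a i') + d (?a i') (?b i')"
          using Md.triangle [of "?b i" "?a i" "?b i'"] Md.triangle [of "?a i" "?a i'" "?b i'"] M i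
          by fastforce
        then show ?thesis
          using fary [OF *] close [OF i(1)] close [OF i(2)] Md.commute [of "?a i" "?b i"] by linarith
      qed
      then have "\<delta>/2 < sep ((?S ^^ m) x) j"
        unfolding sep_def min_separation_ge_iff(2) [OF assms(2)] by blast
      then show ?thesis by (simp add: sepS x)
    qed
    then have "\<delta> / 2 < sep x k" if "k \<in> {m..m + L}" for k
      using that by (metis atLeastAtMost_iff le_add_diff_inverse2 le_diff_conv add.commute)
    with m(1) have "{m..m + L} \<subseteq> {k. 1 \<le> k \<and> \<delta> / 2 < sep x k}" by auto
    with m(1) show "\<exists>m\<ge>1. {m..m + L} \<subseteq> {k. 1 \<le> k \<and> \<delta> / 2 < sep x k}" by auto
  qed auto

  \<comment> \<open>Here \<delta> is kept: the strict bound along the orbit of \<open>x\<close>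
    becomes a weak one on its limit points, and the lower limit asks for no more.\<close>
  have proximal_if_thick: "\<exists>y\<in>?N. minimal_point ?N D ?S y \<and> proximal D ?S x y \<and> ?far \<delta> y"
    if x: "x \<in> ?N" and thick: "thick {k. 1 \<le> k \<and> \<delta> < sep x k}" for x \<delta>
  proof -
    define Q where "Q = ND.mtopology closure_of range (\<lambda>k. (?S ^^ k) x)"
    define G where "G = {z \<in> ?N. \<delta> \<le> min_separation d n z}"
    \<comment> \<open>The sets \<open>C L\<close> are closed and decrease with \<open>L\<close>;
      each contains an iterate of \<open>x\<close> that starts a long enough window of separated
      times. By compactness some point has all its iterates in \<open>G\<close>.\<close>
    define C where "C L = {z \<in> Q. \<forall>k\<le>L. (?S ^^ k) z \<in> G}" for L :: nat
    have QN: "Q \<subseteq> ?N" unfolding Q_def using closure_of_subset_topspace [of ND.mtopology] by simp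
    have clQ: "closedin ND.mtopology Q" by (simp add: Q_def)
    have clG: "closedin ND.mtopology G"
      unfolding G_def top by (rule Md.closedin_min_separation [OF assms(2)])
    have orbQ: "(?S ^^ k) x \<in> Q" for k
      using closure_of_subset [of "range (\<lambda>k. (?S ^^ k) x)" ND.mtopology] SkN [OF x]
      by (auto simp: Q_def)
    have "?S ` range (\<lambda>k. (?S ^^ k) x) \<subseteq> range (\<lambda>k. (?S ^^ k) x)"
      by (auto intro: range_eqI [of _ _ "Suc k" for k])
    then have SQ: "?S ` Q \<subseteq> Q"
      unfolding Q_def using continuous_map_image_closure_subset [OF S] closure_of_mono by blast
    have clC: "closedin ND.mtopology (C L)" for L
    proof -
      have "C L = (\<Inter>k\<in>{..L}. {z \<in> Q. (?S ^^ k) z \<in> G})" by (auto simp: C_def)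
      moreover have "closedin ND.mtopology {z \<in> Q. (?S ^^ k) z \<in> G}" for k
        by (intro closedin_continuous_map_preimage_gen [OF _ clQ clG] continuous_map_funpow S)
      ultimately show ?thesis by (auto intro!: closedin_Inter)
    qed
    have neC: "C L \<noteq> {}" for L
    proof -
      \<comment> \<open>Thickness speaks of lengths at least 1, so \<open>L = 0\<close> is served by
        a longer window.\<close>
      obtain m where m: "{m..m + max L 1} \<subseteq> {k. 1 \<le> k \<and> \<delta> < sep x k}"
        using thick unfolding thick_def by (meson max.cobounded2)
      have "(?S ^^ k) ((?S ^^ m) x) \<in> G" if "k \<le> L" for k
      proof -
        have "k + m \<in> {m..m + max L 1}" using that by auto
        then have "\<delta> < sep x (k + m)" using m by blast
        then show ?thesis
          using SkN [OF x, of "k + m"] by (simp add: G_def sep x funpow_add)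
      qed
      then show ?thesis using orbQ [of m] by (auto simp: C_def)
    qed
    define A where "A = (\<Inter>L. C L)"
    have A: "closedin ND.mtopology A" unfolding A_def using clC by auto
    have neA: "A \<noteq> {}"
      unfolding A_def by (rule compact_space_imp_nest [OF cN clC neC]) (auto simp: C_def decseq_def)
    have AG: "(?S ^^ k) z \<in> G" if "z \<in> A" for z k
      using that by (auto simp: A_def C_def)
    have AQ: "A \<subseteq> Q" by (auto simp: A_def C_def)
    have SA: "?S ` A \<subseteq> A"
    proof clarify
      fix z assume z: "z \<in> A"
      have "(?S ^^ k) (?S z) \<in> G" for k
        using AG [OF z, of "Suc k"] by (simp only: funpow_Suc_right o_apply)
      then show "?S z \<in> A" using SQ AQ z by (auto simp: A_def C_def)
    qed
    have inv: "?S ` \<Inter>\<C> \<subseteq> \<Inter>\<C>" if "\<And>C. C \<in> \<C> \<Longrightarrow> ?S ` C \<subseteq> C" for \<C>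
      using that by blast
    \<comment> \<open>The proximal partner is sought in a minimal invariant set inside
      \<open>A\<close>: minimality makes it a minimal point, and \<open>A\<close> keeps it separated
      at all times.\<close>
    obtain B where B: "closedin ND.mtopology B" "B \<noteq> {}" "?S ` B \<subseteq> B" "B \<subseteq> A"
      and min: "\<And>C. \<lbrakk>closedin ND.mtopology C; C \<noteq> {}; ?S ` C \<subseteq> C; C \<subseteq> B\<rbrakk> \<Longrightarrow> C = B"
      by (rule minimal_closed_subset_exists [where P = "\<lambda>C. ?S ` C \<subseteq> C", OF cN A neA SA inv])
        (assumption, rule that)
    have BQ: "B \<subseteq> ND.mtopology closure_of range (\<lambda>k. (?S ^^ k) x)"
      using B(4) AQ by (simp add: Q_def)
    have xt: "x \<in> topspace ND.mtopology" using x by simp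
    obtain y where y: "y \<in> B"
      and near: "\<And>W. openin ND.mtopology W \<Longrightarrow> y \<in> W \<Longrightarrow> \<exists>k. (?S ^^ k) x \<in> W \<and> (?S ^^ k) y \<in> W"
      using auslander_ellis [OF cN ND.Hausdorff_space_mtopology S xt B(1,2,3) BQ] by blast
    have yN: "y \<in> ?N" using y B(4) AQ QN by blast
    have "minimal_point ?N D ?S y" by (rule ND.minimal_pointI [OF S B(1,3) y min])
    moreover have "proximal D ?S x y"
    proof (rule ND.proximalI [OF SN x yN])
      fix \<epsilon> :: real assume "\<epsilon> > 0"
      then obtain k where k: "(?S ^^ k) x \<in> ND.mball y (\<epsilon>/2)" "(?S ^^ k) y \<in> ND.mball y (\<epsilon>/2)"
        using near [OF ND.openin_mball, of y "\<epsilon>/2"] yN by (metis ND.centre_in_mball_iff half_gt_zero)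
      then have "D ((?S ^^ k) x) ((?S ^^ k) y) < \<epsilon>"
        using ND.triangle'' [of y "(?S ^^ k) y" "(?S ^^ k) x"]
          ND.triangle [of "(?S ^^ k) x" y "(?S ^^ k) y"] ND.commute [of y "(?S ^^ k) x"]
        unfolding ND.in_mball by linarith
      then show "\<exists>k. D ((?S ^^ k) x) ((?S ^^ k) y) < \<epsilon>" ..
    qed
    moreover have "\<delta> \<le> sep y m" for m
      using AG [of y m] y B(4) by (auto simp: G_def sep [OF yN])
    then have "?far \<delta> y" by (intro Liminf_bounded) simp
    ultimately show ?thesis using yN by blast
  qed

  have sub: "x \<in> ?N" if "openin Md.mtopology U" "x \<in> {1..n} \<rightarrow>\<^sub>E U" for U x
    using that openin_subset [OF that(1)] by (auto simp: PiE_iff)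
  let ?P1 = "tuplewise_thickly_sensitive n M d T"
  let ?P2 = "\<exists>\<delta>>0. \<forall>U. openin Md.mtopology U \<and> U \<noteq> {} \<longrightarrow>
      (\<exists>x\<in>{1..n} \<rightarrow>\<^sub>E U. \<exists>y\<in>?N. proximal D ?S x y \<and> ?far \<delta> y)"
  let ?P3 = "\<exists>\<delta>>0. \<forall>U. openin Md.mtopology U \<and> U \<noteq> {} \<longrightarrow>
      (\<exists>x\<in>{1..n} \<rightarrow>\<^sub>E U. \<exists>y\<in>?N. minimal_point ?N D ?S y \<and> proximal D ?S x y \<and> ?far \<delta> y)"
  \<comment> \<open>The implications run from (1) to (3) with the same \<delta>, from (3) to (2) by
    dropping minimality, and from (2) back to (1) with \<delta>/2.\<close>
  have "?P3" if ?P1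
    using that unfolding sens
  proof (elim exE conjE, intro exI conjI allI impI)
    fix \<delta> U assume \<delta>: "\<forall>U. openin Md.mtopology U \<and> U \<noteq> {} \<longrightarrow>
        (\<exists>x\<in>{1..n} \<rightarrow>\<^sub>E U. thick {k. 1 \<le> k \<and> \<delta> < sep x k})"
      and U: "openin Md.mtopology U \<and> U \<noteq> {}"
    obtain x where x: "x \<in> {1..n} \<rightarrow>\<^sub>E U" "thick {k. 1 \<le> k \<and> \<delta> < sep x k}"
      using \<delta> [rule_format, OF U] by (elim bexE)
    show "\<exists>x\<in>{1..n} \<rightarrow>\<^sub>E U. \<exists>y\<in>?N. minimal_point ?N D ?S y \<and> proximal D ?S x y \<and> ?far \<delta> y"
      by (intro bexI [OF _ x(1)] proximal_if_thick [OF sub [OF conjunct1 [OF U] x(1)] x(2)])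
  qed
  moreover have "?P2" if ?P3 using that by meson
  moreover have "?P1" if ?P2
    using that unfolding sens
  proof (elim exE conjE, intro exI conjI allI impI)
    fix \<delta> :: real assume "\<delta> > 0"
    then show "\<delta> / 2 > 0" by simp
    fix U assume \<delta>: "\<forall>U. openin Md.mtopology U \<and> U \<noteq> {} \<longrightarrow>
        (\<exists>x\<in>{1..n} \<rightarrow>\<^sub>E U. \<exists>y\<in>?N. proximal D ?S x y \<and> ?far \<delta> y)"
      and U: "openin Md.mtopology U \<and> U \<noteq> {}"
    obtain x y where xy: "x \<in> {1..n} \<rightarrow>\<^sub>E U" "y \<in> ?N" "proximal D ?S x y" "?far \<delta> y"
      using \<delta> [rule_format, OF U] by (elim bexE conjE)
    show "\<exists>x\<in>{1..n} \<rightarrow>\<^sub>E U. thick {k. 1 \<le> k \<and> \<delta> / 2 < sep x k}"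
      by (intro bexI [OF _ xy(1)]
          thick_if_proximal [OF \<open>\<delta> > 0\<close> sub [OF conjunct1 [OF U] xy(1)] xy(2-4)])
  qed
  ultimately have "(?P1 \<longleftrightarrow> ?P2) \<and> (?P1 \<longleftrightarrow> ?P3)" by argo
  then show ?thesis unfolding sep_def .
qed

end
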